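(* Let $V$ be a finite-dimensional real vector space, let $D\subset V$ be an ellipsoid, and let $d$ be the Hilbert metric on $D$. Let $F:D\to D$ be a nonexpansive mapping with respect to $d$ without fixed points, and for $\lambda>0$ let $R_\lambda:D\to D$ be the resolvent of $F$. Then there exists $\xi\in\partial D$ such that $\{R_\lambda\}_{\lambda>0}$ converges, as $\lambda\to\infty$, uniformly on bounded sets of $D$ to $\xi$; that is, for every subset $K\subset D$ bounded with respect to $d$, $\sup_{x\in K}\|R_\lambda(x)-\xi\|\to 0$ as $\lambda\to\infty$.
   Context: $V$ carries a norm $\|\cdot\|$ (its topology is the usual Euclidean one); $\overline D$ is the norm closure of $D$ and $\partial D=\overline D\setminus D$. An ellipsoid here is an open solid ellipsoid (the image of an open Euclidean ball under an invertible affine map), which is in particular a bounded convex domain. Hilbert metric: for distinct $x,y\in D$, the straight line through $x$ and $y$ meets $\partial D$ in exactly two points $a,b$, labelled so that $x$ is between $a$ and $y$, and $y$ is between $x$ and $b$. Then $d(x,y)=\log\left(\frac{\|y-a\|\,\|x-b\|}{\|x-a\|\,\|y-b\|}\right)$, and $d(x,x)=0$. A map $F:D\to D$ is nonexpansive (with respect to $d$) if $d(F(x),F(y))\le d(x,y)$ for all $x,y\in D$. Resolvents: for a nonexpansive $F:D\to D$, $x\in D$ and $\lambda>0$, the map $G_{x,\lambda}(y)=\frac{1}{1+\lambda}x+\frac{\lambda}{1+\lambda}F(y)$, $y\in D$, maps $D$ into $D$ and has a unique fixed point $z\in D$; the resolvent is defined by $R_\lambda(x)=z$. Thus $R_\lambda(x)$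 is the unique point of $D$ satisfying $R_\lambda(x)=\frac{1}{1+\lambda}x+\frac{\lambda}{1+\lambda}F(R_\lambda(x))$. *)

theory Defs
  imports "HOL-Analysis.Analysis"
begin

text \<open>
  The ambient space is a type of class \<open>real_normed_vector\<close> carrying an arbitrary norm, so an
  ellipsoid in it is the image of a Euclidean ball of some \<open>real ^ 'n\<close> under a bijective affine
  map.  The index type \<open>'n\<close> does not occur in the type of \<open>D\<close> and is passed explicitly; bijectivity
  forces \<open>CARD('n)\<close> to be the dimension of the ambient space.
\<close>

definition ellipsoid :: "'n::finite itself \<Rightarrow> 'a::real_normed_vector set \<Rightarrow> bool" where
  "ellipsoid (_ :: 'n itself) D \<longleftrightarrow>
     (\<exists>(L :: real ^ 'n \<Rightarrow> 'a) c p r.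
        linear L \<and> bij L \<and> 0 < r \<and> D = (\<lambda>v. c + L v) ` ball p r)"

definition norm_boundary :: "'a::real_normed_vector set \<Rightarrow> 'a set" where
  "norm_boundary D = closure D - D"

text \<open>
  The point where the line through \<open>x\<close> and \<open>y\<close> leaves \<open>D\<close> on the side of \<open>x\<close>.  It is unique when
  \<open>D\<close> is a bounded open convex set and \<open>x \<noteq> y\<close> are in \<open>D\<close>.  The exit point on the side of \<open>y\<close> is
  obtained by swapping the arguments.
\<close>

definition exit_point :: "'a::real_normed_vector set \<Rightarrow> 'a \<Rightarrow> 'a \<Rightarrow> 'a" where
  "exit_point D x y =
     (THE a. a \<in> affine hull {x, y} \<and> a \<in> norm_boundary D \<and> x \<in> closed_segment a y)"

definition hilbert_metric :: "'a::real_normed_vector set \<Rightarrow> 'a \<Rightarrow> 'a \<Rightarrow> real" where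
  "hilbert_metric D x y =
     (if x = y then 0
      else (let a = exit_point D x y; b = exit_point D y x
            in ln ((norm (y - a) * norm (x - b)) / (norm (x - a) * norm (y - b)))))"

definition hilbert_nonexpansive :: "'a::real_normed_vector set \<Rightarrow> ('a \<Rightarrow> 'a) \<Rightarrow> bool" where
  "hilbert_nonexpansive D F \<longleftrightarrow>
     (\<forall>x\<in>D. \<forall>y\<in>D. hilbert_metric D (F x) (F y) \<le> hilbert_metric D x y)"

definition hilbert_bounded :: "'a::real_normed_vector set \<Rightarrow> 'a set \<Rightarrow> bool" where
  "hilbert_bounded D K \<longleftrightarrow> (\<exists>M. \<forall>x\<in>K. \<forall>y\<in>K. hilbert_metric D x y \<le> M)"

definition resolvent :: "'a::real_normed_vector set \<Rightarrow> ('a \<Rightarrow> 'a) \<Rightarrow> real \<Rightarrow> 'a \<Rightarrow> 'a" where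
  "resolvent D F l x =
     (THE z. z \<in> D \<and> (1 / (1 + l)) *\<^sub>R x + (l / (1 + l)) *\<^sub>R F z = z)"

end

theory Submission
  imports Defs
begin

text \<open>
  An affine map turns the ellipsoid into the Euclidean unit ball, where the Hilbert metric is an
  increasing function of \<open>C x y = (1 - x \<bullet> y) / sqrt ((1 - x \<bullet> x) * (1 - y \<bullet> y))\<close>. As \<open>\<lambda>\<close> tends to
  infinity, \<open>R\<^sub>\<lambda> x - F (R\<^sub>\<lambda> x)\<close> tends to \<open>0\<close>, so all cluster points \<open>\<zeta>\<close> of resolvents lie on the sphere.
  Since \<open>1 - norm\<^sup>2\<close> is at least about as large at \<open>R\<^sub>\<lambda> x\<close> as at \<open>F (R\<^sub>\<lambda> x)\<close>, passing to the limit in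
  \<open>C (F y) (F (R\<^sub>\<lambda> x)) \<le> C y (R\<^sub>\<lambda> x)\<close> shows that \<open>F\<close> preserves the horoballs at \<open>\<zeta>\<close>. Two different cluster
  points would give a compact convex invariant intersection of horoballs inside the ball, and
  Brouwer's theorem a fixed point.
\<close>

section \<open>Hyperbolic distance in the Klein model of the ball\<close>

text \<open>\<open>klein_cosh\<close> is \<open>cosh (d x y / 2)\<close> for the Hilbert metric \<open>d\<close> of the unit ball.\<close>

definition klein_cosh :: "'b::real_inner \<Rightarrow> 'b \<Rightarrow> real" where
  "klein_cosh x y = (1 - x \<bullet> y) / (sqrt (1 - x \<bullet> x) * sqrt (1 - y \<bullet> y))"

lemma one_minus_inner_self_pos:
  fixes x :: "'b::real_inner"
  assumes "x \<in> ball 0 1"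
  shows "0 < 1 - x \<bullet> x"
  using assms by (simp add: dot_square_norm power_less_one_iff abs_square_less_1)

lemma one_minus_inner_pos:
  fixes x y :: "'b::real_inner"
  assumes "x \<in> ball 0 1" "norm y \<le> 1"
  shows "0 < 1 - x \<bullet> y"
proof -
  have "x \<bullet> y \<le> norm x * norm y" by (rule norm_cauchy_schwarz)
  also have "\<dots> \<le> norm x * 1" using assms by (intro mult_left_mono) auto
  also have "\<dots> < 1" using assms by simp
  finally show ?thesis by simp
qed

lemma one_minus_inner_polarization:
  fixes x y :: "'b::real_inner"
  shows "2 * (1 - x \<bullet> y) = (1 - x \<bullet> x) + (1 - y \<bullet> y) + (norm (x - y))\<^sup>2"
  by (simp add: power2_norm_eq_inner inner_diff_left inner_diff_right inner_commute)

text \<open>With \<open>a\<close>, \<open>b\<close> the two square roots and \<open>c\<close> the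
  value of \<open>klein_cosh\<close>, polarization expresses the squared distance through
  \<open>a\<close>, \<open>b\<close>, \<open>c\<close>; it is at most
  \<open>2 * (a * b) * (c - 1)\<close> by AM-GM, and \<open>a * b \<le> 1\<close>. This estimate
  links hyperbolic distances to the norm topology.\<close>

lemma dist_le_klein_cosh:
  fixes x y :: "'b::real_inner"
  assumes "x \<in> ball 0 1" "y \<in> ball 0 1"
  shows "(norm (x - y))\<^sup>2 \<le> 2 * (klein_cosh x y - 1)"
proof -
  define a b where "a = sqrt (1 - x \<bullet> x)" and "b = sqrt (1 - y \<bullet> y)"
  have pos: "0 < a" "0 < b"
    using one_minus_inner_self_pos assms by (auto simp: a_def b_def)
  have sq: "a\<^sup>2 = 1 - x \<bullet> x" "b\<^sup>2 = 1 - y \<bullet> y"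
    using one_minus_inner_self_pos[OF assms(1)] one_minus_inner_self_pos[OF assms(2)]
    by (auto simp: a_def b_def)
  have le: "a * b \<le> 1"
    using pos by (intro mult_le_one) (auto simp: a_def b_def)
  define c where "c = klein_cosh x y"
  have p: "1 - x \<bullet> y = a * b * c"
    using pos by (simp add: c_def klein_cosh_def a_def b_def)
  have "(norm (x - y))\<^sup>2 = 2 * (a * b * c) - a\<^sup>2 - b\<^sup>2"
    using one_minus_inner_polarization[of x y] p sq by simp
  also have "\<dots> \<le> (a * b) * (2 * (c - 1))"
    using sum_squares_ge_zero[of "a - b" 0] by (simp add: algebra_simps power2_eq_square)
  finally have *: "(norm (x - y))\<^sup>2 \<le> (a * b) * (2 * (c - 1))" .
  \<comment> \<open>That \<open>c\<close> is at least 1 is read off from the bound itself, since a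
    square cannot be negative; only then may \<open>a * b\<close> be replaced by 1.\<close>
  then have "0 \<le> (a * b) * (2 * (c - 1))"
    using zero_le_power2 order_trans by blast
  then have "0 \<le> 2 * (c - 1)"
    using pos by (meson mult_pos_pos zero_le_mult_iff not_le)
  then have "(a * b) * (2 * (c - 1)) \<le> 1 * (2 * (c - 1))"
    using le by (intro mult_right_mono)
  with * show ?thesis by (simp add: c_def)
qed

lemma klein_cosh_ge_1:
  fixes x y :: "'b::real_inner"
  assumes "x \<in> ball 0 1" "y \<in> ball 0 1"
  shows "1 \<le> klein_cosh x y"
  using order_trans[OF zero_le_power2 dist_le_klein_cosh[OF assms]] by simp

lemma klein_cosh_gt_1:
  fixes x y :: "'b::real_inner"
  assumes "x \<in> ball 0 1" "y \<in> ball 0 1" "x \<noteq> y"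
  shows "1 < klein_cosh x y"
proof -
  have "0 < (norm (x - y))\<^sup>2" using assms by simp
  from less_le_trans[OF this dist_le_klein_cosh[OF assms(1,2)]] show ?thesis by simp
qed

lemma klein_cosh_self:
  fixes x :: "'b::real_inner"
  assumes "x \<in> ball 0 1"
  shows "klein_cosh x x = 1"
  using one_minus_inner_self_pos[OF assms] by (simp add: klein_cosh_def)

lemma klein_cosh_power2:
  fixes x y :: "'b::real_inner"
  assumes "x \<in> ball 0 1" "y \<in> ball 0 1"
  shows "(klein_cosh x y)\<^sup>2 = (1 - x \<bullet> y)\<^sup>2 / ((1 - x \<bullet> x) * (1 - y \<bullet> y))"
  using one_minus_inner_self_pos[OF assms(1)] one_minus_inner_self_pos[OF assms(2)]
  by (simp add: klein_cosh_def power_divide power_mult_distrib)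

section \<open>Strict contraction by homotheties\<close>

text \<open>Expanding both sides in \<open>s\<close> and \<open>t\<close> leaves two estimates:
  \<open>sum_le\<close> bounds the mixed term of the numerator, and \<open>CS\<close> bounds the
  denominator from below by geometric means. Strictness is what makes resolvents unique.\<close>

lemma klein_cosh_homothety_less:
  fixes x u v :: "'b::real_inner"
  assumes x: "x \<in> ball 0 1" and u: "u \<in> ball 0 1" and v: "v \<in> ball 0 1" and "u \<noteq> v"
    and s: "0 < s" and t: "0 < t" and st: "s + t = 1"
    and h: "s *\<^sub>R x + t *\<^sub>R u \<in> ball 0 1" "s *\<^sub>R x + t *\<^sub>R v \<in> ball 0 1"
  shows "klein_cosh (s *\<^sub>R x + t *\<^sub>R u) (s *\<^sub>R x + t *\<^sub>R v) < klein_cosh u v"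
proof -
  define a b q \<alpha> \<beta> p where "a = sqrt (1 - u \<bullet> u)" and "b = sqrt (1 - v \<bullet> v)"
    and "q = 1 - x \<bullet> x" and "\<alpha> = 1 - x \<bullet> u" and "\<beta> = 1 - x \<bullet> v" and "p = 1 - u \<bullet> v"
  define c where "c = klein_cosh u v"
  have pos: "0 < a" "0 < b" "0 < q" "0 < \<alpha>" "0 < \<beta>"
    using one_minus_inner_self_pos[OF u] one_minus_inner_self_pos[OF v]
      one_minus_inner_self_pos[OF x] one_minus_inner_pos[OF x, of u] one_minus_inner_pos[OF x, of v] u v
    by (auto simp: a_def b_def q_def \<alpha>_def \<beta>_def)
  have sq: "a\<^sup>2 = 1 - u \<bullet> u" "b\<^sup>2 = 1 - v \<bullet> v"
    using one_minus_inner_self_pos[OF u] one_minus_inner_self_pos[OF v] by (auto simp: a_def b_def)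
  have c1: "1 < c" unfolding c_def by (rule klein_cosh_gt_1) fact+
  have p: "p = a * b * c"
    using pos by (simp add: c_def klein_cosh_def a_def b_def p_def)
  have p0: "0 \<le> p" unfolding p using pos c1 by simp
  have ab: "a\<^sup>2 + b\<^sup>2 \<le> 2 * p"
    using one_minus_inner_polarization[of u v] sq by (simp add: p_def)
  have mix: "\<beta>\<^sup>2 * a\<^sup>2 + \<alpha>\<^sup>2 * b\<^sup>2 \<le> 2 * \<alpha> * \<beta> * p"
  proof -
    \<comment> \<open>Lifting \<open>x\<close> to \<open>X = (1, x)\<close>, the vector \<open>\<beta> U - \<alpha> V\<close> is Lorentz orthogonal to the timelike
      vector \<open>X\<close>, hence spacelike.\<close>
    define w where "w = \<beta> *\<^sub>R u - \<alpha> *\<^sub>R v"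
    have "x \<bullet> w = \<beta> - \<alpha>"
      by (simp add: w_def \<alpha>_def \<beta>_def algebra_simps)
    then have "(\<beta> - \<alpha>)\<^sup>2 \<le> (x \<bullet> x) * (w \<bullet> w)"
      using Cauchy_Schwarz_ineq[of x w] by simp
    also have "\<dots> \<le> 1 * (w \<bullet> w)"
      using pos by (intro mult_right_mono) (auto simp: q_def)
    also have "w \<bullet> w = \<beta>\<^sup>2 * (1 - a\<^sup>2) - 2 * \<alpha> * \<beta> * (1 - p) + \<alpha>\<^sup>2 * (1 - b\<^sup>2)"
      unfolding sq p_def
      by (simp add: w_def inner_diff_left inner_diff_right inner_commute power2_eq_square)
    finally show ?thesis by (simp add: algebra_simps power2_eq_square)
  qed
  define g where "g = sqrt (\<alpha> * \<beta>)"
  have g: "0 < g" "g\<^sup>2 = \<alpha> * \<beta>" using pos by (auto simp: g_def)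
  \<comment> \<open>Cauchy-Schwarz for the vectors \<open>(a, b)\<close> and
    \<open>(\<alpha> * b, \<beta> * a)\<close> bounds \<open>a * b * (\<alpha> + \<beta>)\<close>;
    the defect is the square of \<open>\<beta> * a\<^sup>2 - \<alpha> * b\<^sup>2\<close>. The two
    factors are then estimated by \<open>ab\<close> and \<open>mix\<close>.\<close>
  have sum_le: "\<alpha> + \<beta> \<le> 2 * c * g"
  proof -
    have "(a * b)\<^sup>2 * (\<alpha> + \<beta>)\<^sup>2 \<le> (a\<^sup>2 + b\<^sup>2) * (\<beta>\<^sup>2 * a\<^sup>2 + \<alpha>\<^sup>2 * b\<^sup>2)"
      using zero_le_power2[of "\<beta> * a\<^sup>2 - \<alpha> * b\<^sup>2"]
      by (simp add: power2_eq_square algebra_simps)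
    also have "\<dots> \<le> (2 * p) * (2 * \<alpha> * \<beta> * p)"
      using p0 by (intro mult_mono ab mix) auto
    also have "\<dots> = (a * b)\<^sup>2 * (2 * c * g)\<^sup>2"
      using g by (simp add: p power_mult_distrib) (simp add: power2_eq_square)
    finally have "(a * b)\<^sup>2 * (\<alpha> + \<beta>)\<^sup>2 \<le> (a * b)\<^sup>2 * (2 * c * g)\<^sup>2" .
    moreover have "0 < (a * b)\<^sup>2" using pos(1,2) by simp
    ultimately have "(\<alpha> + \<beta>)\<^sup>2 \<le> (2 * c * g)\<^sup>2" by (rule mult_left_le_imp_le)
    then show ?thesis by (rule power2_le_imp_le) (use c1 g(1) in simp)
  qed
  define A B where "A = s\<^sup>2 * q + 2 * s * t * \<alpha> + t\<^sup>2 * a\<^sup>2"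
    and "B = s\<^sup>2 * q + 2 * s * t * \<beta> + t\<^sup>2 * b\<^sup>2"
  let ?U = "s *\<^sub>R x + t *\<^sub>R u" and ?V = "s *\<^sub>R x + t *\<^sub>R v"
  \<comment> \<open>Writing 1 as the square of \<open>s + t\<close> makes
    \<open>1 - ?U \<bullet> ?V\<close> homogeneous in \<open>s\<close> and \<open>t\<close>: it is
    the Lorentz form of the lifted vectors \<open>(1, ?U)\<close> and
    \<open>(1, ?V)\<close>.\<close>
  have one: "1 = s\<^sup>2 + 2 * s * t + t\<^sup>2"
    using power2_sum[of s t] st by simp
  have A: "1 - ?U \<bullet> ?U = A"
    unfolding A_def q_def \<alpha>_def sq using one
    by (simp add: inner_commute algebra_simps power2_eq_square)
  have B: "1 - ?V \<bullet> ?V = B"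
    unfolding B_def q_def \<beta>_def sq using one
    by (simp add: inner_commute algebra_simps power2_eq_square)
  have AB: "1 - ?U \<bullet> ?V = s\<^sup>2 * q + s * t * (\<alpha> + \<beta>) + t\<^sup>2 * p"
    unfolding q_def \<alpha>_def \<beta>_def p_def using one
    by (simp add: inner_commute algebra_simps power2_eq_square)
  have ApBp: "0 < A" "0 < B"
    using one_minus_inner_self_pos h A B by metis+
  \<comment> \<open>\<open>A\<close> and \<open>B\<close> are sums of three positive terms, and the
    left side adds the geometric means of corresponding terms. This is Cauchy-Schwarz, proved by
    AM-GM on each of the three cross terms of \<open>A * B\<close>.\<close>
  have CS: "(s\<^sup>2 * q + 2 * s * t * g + t\<^sup>2 * (a * b)) \<le> sqrt (A * B)"
  proof (rule real_le_rsqrt)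
    define k where "k = s\<^sup>2 * q"
    define m where "m = 2 * s * t"
    have km: "0 < k" "0 < m" using pos s t by (auto simp: k_def m_def)
    have gsum: "2 * g \<le> \<alpha> + \<beta>"
      using arith_geo_mean_sqrt[of \<alpha> \<beta>] pos by (simp add: g_def)
    have 1: "k * (m * (2 * g)) \<le> k * (m * (\<alpha> + \<beta>))"
      using km gsum by simp
    have 2: "k * (t\<^sup>2 * (2 * (a * b))) \<le> k * (t\<^sup>2 * (a\<^sup>2 + b\<^sup>2))"
      using km sum_squares_bound[of a b] by (intro mult_left_mono) auto
    have 3: "m * (t\<^sup>2 * (2 * g * (a * b))) \<le> m * (t\<^sup>2 * (\<alpha> * b\<^sup>2 + \<beta> * a\<^sup>2))"
    proof -
      have "g * (a * b) = sqrt ((\<alpha> * b\<^sup>2) * (\<beta> * a\<^sup>2))"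
        using pos by (simp add: g_def real_sqrt_mult)
      then have "2 * g * (a * b) \<le> \<alpha> * b\<^sup>2 + \<beta> * a\<^sup>2"
        using arith_geo_mean_sqrt[of "\<alpha> * b\<^sup>2" "\<beta> * a\<^sup>2"] pos by simp
      then show ?thesis using km by (intro mult_left_mono) auto
    qed
    have "(k + m * g + t\<^sup>2 * (a * b))\<^sup>2 = k\<^sup>2 + m\<^sup>2 * g\<^sup>2 + (t\<^sup>2 * (a * b))\<^sup>2
        + k * (m * (2 * g)) + k * (t\<^sup>2 * (2 * (a * b))) + m * (t\<^sup>2 * (2 * g * (a * b)))"
      by (simp add: power2_eq_square algebra_simps)
    also have "\<dots> \<le> k\<^sup>2 + m\<^sup>2 * g\<^sup>2 + (t\<^sup>2 * (a * b))\<^sup>2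
        + k * (m * (\<alpha> + \<beta>)) + k * (t\<^sup>2 * (a\<^sup>2 + b\<^sup>2)) + m * (t\<^sup>2 * (\<alpha> * b\<^sup>2 + \<beta> * a\<^sup>2))"
      using 1 2 3 by linarith
    also have "\<dots> = (k + m * \<alpha> + t\<^sup>2 * a\<^sup>2) * (k + m * \<beta> + t\<^sup>2 * b\<^sup>2)"
      unfolding g by (simp add: power2_eq_square algebra_simps)
    finally show "(s\<^sup>2 * q + 2 * s * t * g + t\<^sup>2 * (a * b))\<^sup>2 \<le> A * B"
      by (simp add: k_def m_def A_def B_def)
  qed
  \<comment> \<open>The strict inequality comes from the contribution of the center
    \<open>x\<close>, as \<open>c\<close> exceeds 1.\<close>
  have "s\<^sup>2 * q < c * (s\<^sup>2 * q)" using c1 pos s by simp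
  moreover have "s * t * (\<alpha> + \<beta>) \<le> s * t * (2 * c * g)"
    using sum_le s t by simp
  ultimately have "1 - ?U \<bullet> ?V < c * (s\<^sup>2 * q + 2 * s * t * g + t\<^sup>2 * (a * b))"
    unfolding AB p by (simp add: algebra_simps)
  also have "\<dots> \<le> c * sqrt (A * B)"
    using CS c1 by simp
  finally show ?thesis
    using ApBp by (simp add: klein_cosh_def[of ?U] A B c_def divide_less_eq real_sqrt_mult)
qed

section \<open>Continuity and resolvents in the ball\<close>

lemma convex_comb_in_ball:
  fixes x y :: "'b::real_normed_vector"
  assumes "x \<in> ball 0 1" "norm y \<le> 1" "0 < s" "0 \<le> t" "s + t = 1"
  shows "s *\<^sub>R x + t *\<^sub>R y \<in> ball 0 1"
proof -
  have "norm (s *\<^sub>R x + t *\<^sub>R y) \<le> s * norm x + t * norm y"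
    using assms by (intro norm_triangle_le) simp
  moreover have "s * norm x < s * 1" using assms by (intro mult_strict_left_mono) auto
  moreover have "t * norm y \<le> t * 1" using assms by (intro mult_left_mono) auto
  ultimately have "norm (s *\<^sub>R x + t *\<^sub>R y) < s + t" by linarith
  then show ?thesis using \<open>s + t = 1\<close> by simp
qed

text \<open>As \<open>y\<close> tends to \<open>x\<close>, \<open>klein_cosh x y\<close> tends to 1,
  and \<open>dist_le_klein_cosh\<close> bounds the distance of the images by the excess over
  1.\<close>

lemma klein_nonexpansive_imp_continuous_on:
  fixes f :: "'b::real_inner \<Rightarrow> 'b"
  assumes f: "f \<in> ball 0 1 \<rightarrow> ball 0 1"
    and ne: "\<And>x y. x \<in> ball 0 1 \<Longrightarrow> y \<in> ball 0 1 \<Longrightarrow> klein_cosh (f x) (f y) \<le> klein_cosh x y"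
  shows "continuous_on (ball 0 1) f"
  unfolding continuous_on_def
proof
  fix x :: 'b assume x: "x \<in> ball 0 1"
  let ?F = "at x within ball 0 1"
  have "((\<lambda>y. klein_cosh x y) \<longlongrightarrow> klein_cosh x x) ?F"
    unfolding klein_cosh_def using one_minus_inner_self_pos[OF x]
    by (intro tendsto_intros) auto
  then have "((\<lambda>y. sqrt (2 * (klein_cosh x y - 1))) \<longlongrightarrow> sqrt (2 * (klein_cosh x x - 1))) ?F"
    by (intro tendsto_intros)
  then have lim: "((\<lambda>y. sqrt (2 * (klein_cosh x y - 1))) \<longlongrightarrow> 0) ?F"
    using klein_cosh_self[OF x] by simp
  have "\<forall>\<^sub>F y in ?F. dist (f y) (f x) \<le> sqrt (2 * (klein_cosh x y - 1))"
    unfolding eventually_at_filter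
  proof (rule eventuallyI, intro impI)
    fix y :: 'b assume y: "y \<in> ball 0 1"
    have "f x \<in> ball 0 1" "f y \<in> ball 0 1" using f x y by auto
    then have "(norm (f x - f y))\<^sup>2 \<le> 2 * (klein_cosh x y - 1)"
      by (rule order_trans[OF dist_le_klein_cosh]) (use ne[OF x y] in simp)
    then have "norm (f x - f y) \<le> sqrt (2 * (klein_cosh x y - 1))"
      by (rule real_le_rsqrt)
    then show "dist (f y) (f x) \<le> sqrt (2 * (klein_cosh x y - 1))"
      by (simp add: dist_norm norm_minus_commute)
  qed
  then show "(f \<longlongrightarrow> f x) ?F"
    by (intro metric_tendsto_imp_tendsto[OF lim]) (auto elim: eventually_mono)
qed

text \<open>Existence is Brouwer's theorem. Two distinct solutions would be homothetic images of
  their values under \<open>f\<close>, hence strictly closer to each other than these values,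
  against nonexpansiveness.\<close>

lemma klein_resolvent_ex1:
  fixes f :: "'b::euclidean_space \<Rightarrow> 'b"
  assumes f: "f \<in> ball 0 1 \<rightarrow> ball 0 1"
    and ne: "\<And>x y. x \<in> ball 0 1 \<Longrightarrow> y \<in> ball 0 1 \<Longrightarrow> klein_cosh (f x) (f y) \<le> klein_cosh x y"
    and x: "x \<in> ball 0 1" and s: "0 < s" and t: "0 < t" and st: "s + t = 1"
  shows "\<exists>!z. z \<in> ball 0 1 \<and> s *\<^sub>R x + t *\<^sub>R f z = z"
proof (rule ex_ex1I)
  \<comment> \<open>Brouwer needs a compact set on which \<open>f\<close> is continuous; the closed
    ball shrunk towards \<open>x\<close> lies in the open ball and contains every value of
    \<open>?g\<close>.\<close>
  let ?K = "(\<lambda>y. s *\<^sub>R x + t *\<^sub>R y) ` cball 0 1"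
  let ?g = "\<lambda>z. s *\<^sub>R x + t *\<^sub>R f z"
  have K: "?K \<subseteq> ball 0 1" using convex_comb_in_ball[OF x] s t st by auto
  have "compact ?K" by (intro compact_continuous_image continuous_intros) auto
  moreover have "convex ?K"
    using convex_affinity[OF convex_cball, of "s *\<^sub>R x" t] by simp
  moreover have "continuous_on ?K ?g"
    using continuous_on_subset[OF klein_nonexpansive_imp_continuous_on[OF f ne] K]
    by (intro continuous_intros)
  moreover have "?g \<in> ?K \<rightarrow> ?K"
  proof
    fix y assume "y \<in> ?K"
    with K have "f y \<in> ball 0 1" using f by blast
    then show "?g y \<in> ?K" by auto
  qed
  ultimately obtain z where "z \<in> ?K" "?g z = z"
    using brouwer[of ?K ?g] by (metis cball_eq_empty image_is_empty not_one_less_zero)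
  with K show "\<exists>z. z \<in> ball 0 1 \<and> ?g z = z" by blast
next
  fix z z' assume *: "z \<in> ball 0 1 \<and> s *\<^sub>R x + t *\<^sub>R f z = z" "z' \<in> ball 0 1 \<and> s *\<^sub>R x + t *\<^sub>R f z' = z'"
  show "z = z'"
  proof (rule ccontr)
    assume "z \<noteq> z'"
    then have "f z \<noteq> f z'" using * by metis
    moreover have "f z \<in> ball 0 1" "f z' \<in> ball 0 1" using f * by auto
    ultimately have "klein_cosh z z' < klein_cosh (f z) (f z')"
      using klein_cosh_homothety_less[of x "f z" "f z'" s t] x s t st * by simp
    with ne[of z z'] * show False by simp
  qed
qed

section \<open>Boundary cluster points and invariant horoballs\<close>

text \<open>\<open>Z n - f (Z n)\<close> is \<open>1 - T n\<close> times a bounded vector, so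
  \<open>f (Z n)\<close> has the same limit, which would be a fixed point if it were interior. The
  second claim says that \<open>(1 - y \<bullet> \<eta>)\<^sup>2 / (1 - y \<bullet> y)\<close>, a
  function of the Busemann function at \<open>\<eta>\<close>, does not increase under
  \<open>f\<close>: horoballs at \<open>\<eta>\<close> are invariant.\<close>

lemma klein_resolvent_cluster_point:
  fixes f :: "'b::euclidean_space \<Rightarrow> 'b"
  assumes f: "f \<in> ball 0 1 \<rightarrow> ball 0 1"
    and ne: "\<And>x y. x \<in> ball 0 1 \<Longrightarrow> y \<in> ball 0 1 \<Longrightarrow> klein_cosh (f x) (f y) \<le> klein_cosh x y"
    and nofix: "\<And>x. x \<in> ball 0 1 \<Longrightarrow> f x \<noteq> x"
    and X: "\<And>n. X n \<in> ball 0 1" and Z: "\<And>n::nat. Z n \<in> ball 0 1"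
    and T: "\<And>n. 0 < T n" "\<And>n. T n < 1" "T \<longlonglongrightarrow> 1"
    and eq: "\<And>n. (1 - T n) *\<^sub>R X n + T n *\<^sub>R f (Z n) = Z n"
    and lim: "Z \<longlonglongrightarrow> \<eta>"
  shows "norm \<eta> = 1"
    and "\<And>y. y \<in> ball 0 1 \<Longrightarrow> (1 - f y \<bullet> \<eta>)\<^sup>2 * (1 - y \<bullet> y) \<le> (1 - y \<bullet> \<eta>)\<^sup>2 * (1 - f y \<bullet> f y)"
proof -
  have fZ: "f (Z n) \<in> ball 0 1" for n using f Z by auto
  have "(\<lambda>n. Z n - f (Z n)) \<longlonglongrightarrow> 0"
  proof (rule Lim_null_comparison)
    show "\<forall>\<^sub>F n in sequentially. norm (Z n - f (Z n)) \<le> (1 - T n) * 2"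
    proof (rule always_eventually, rule allI)
      fix n
      have "Z n - f (Z n) = (1 - T n) *\<^sub>R (X n - f (Z n))"
        by (subst (1) eq[of n, symmetric]) (simp add: algebra_simps)
      then have "norm (Z n - f (Z n)) = (1 - T n) * norm (X n - f (Z n))"
        using T(2)[of n] by simp
      also have "norm (X n - f (Z n)) \<le> 2"
        using norm_triangle_ineq4[of "X n" "f (Z n)"] X[of n] fZ[of n] by simp
      finally show "norm (Z n - f (Z n)) \<le> (1 - T n) * 2"
        using T(2)[of n] by (simp add: mult_left_mono)
    qed
    show "(\<lambda>n. (1 - T n) * 2) \<longlonglongrightarrow> 0"
      using T(3) by (auto intro!: tendsto_eq_intros)
  qed
  from tendsto_diff[OF lim this] have fZlim: "(\<lambda>n. f (Z n)) \<longlonglongrightarrow> \<eta>" by simp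
  have "norm \<eta> \<le> 1"
    using Z by (intro tendsto_upperbound[OF tendsto_norm[OF lim]]) (auto simp: less_imp_le)
  moreover have "\<not> norm \<eta> < 1"
  proof
    assume "norm \<eta> < 1"
    then have \<eta>: "\<eta> \<in> ball 0 1" by simp
    have "(\<lambda>n. f (Z n)) \<longlonglongrightarrow> f \<eta>"
      using continuous_on_tendsto_compose[OF klein_nonexpansive_imp_continuous_on[OF f ne] lim \<eta>] Z
      by simp
    with fZlim have "f \<eta> = \<eta>" using LIMSEQ_unique by blast
    with nofix \<eta> show False by blast
  qed
  ultimately show "norm \<eta> = 1" by simp
  fix y :: 'b assume y: "y \<in> ball 0 1"
  have fy: "f y \<in> ball 0 1" using f y by auto
  note pos = one_minus_inner_self_pos
  show "(1 - f y \<bullet> \<eta>)\<^sup>2 * (1 - y \<bullet> y) \<le> (1 - y \<bullet> \<eta>)\<^sup>2 * (1 - f y \<bullet> f y)"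
  proof (rule LIMSEQ_le)
    show "(\<lambda>n. T n * (1 - f y \<bullet> f (Z n))\<^sup>2 * (1 - y \<bullet> y)) \<longlonglongrightarrow> (1 - f y \<bullet> \<eta>)\<^sup>2 * (1 - y \<bullet> y)"
      using T(3) fZlim by (auto intro!: tendsto_eq_intros)
    show "(\<lambda>n. (1 - y \<bullet> Z n)\<^sup>2 * (1 - f y \<bullet> f y)) \<longlonglongrightarrow> (1 - y \<bullet> \<eta>)\<^sup>2 * (1 - f y \<bullet> f y)"
      using lim by (auto intro!: tendsto_eq_intros)
    show "\<exists>N. \<forall>n\<ge>N. T n * (1 - f y \<bullet> f (Z n))\<^sup>2 * (1 - y \<bullet> y) \<le> (1 - y \<bullet> Z n)\<^sup>2 * (1 - f y \<bullet> f y)"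
    proof (intro exI allI impI)
      fix n
      let ?z = "Z n" and ?w = "f (Z n)"
      \<comment> \<open>Since \<open>X n\<close> has norm at most 1, \<open>?z\<close> is at least
        \<open>T n\<close> times as deep inside the sphere as \<open>?w\<close>. Squaring keeps
        this; the slack is \<open>T n * (1 - T n) * (1 - norm ?w)\<^sup>2\<close>.\<close>
      have "(norm ((1 - T n) *\<^sub>R X n + T n *\<^sub>R ?w)) \<le> (1 - T n) * norm (X n) + T n * norm ?w"
        using T(1,2)[of n] by (intro norm_triangle_le) simp
      moreover have "(1 - T n) * norm (X n) \<le> (1 - T n) * 1"
        using T(2)[of n] X[of n] by (intro mult_left_mono) auto
      ultimately have "norm ?z \<le> (1 - T n) * 1 + T n * norm ?w"
        unfolding eq by linarith
      then have "(norm ?z)\<^sup>2 \<le> (1 - T n * (1 - norm ?w))\<^sup>2"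
        by (intro power_mono) (auto simp: algebra_simps)
      also have "\<dots> \<le> 1 - T n * (1 - (norm ?w)\<^sup>2)"
      proof -
        have "0 \<le> T n * (1 - T n) * (1 - norm ?w)\<^sup>2" using T(1,2)[of n] by simp
        then show ?thesis by (simp add: algebra_simps power2_eq_square)
      qed
      finally have 1: "T n * (1 - ?w \<bullet> ?w) \<le> 1 - ?z \<bullet> ?z"
        by (simp add: power2_norm_eq_inner)
      have "(klein_cosh (f y) ?w)\<^sup>2 \<le> (klein_cosh y ?z)\<^sup>2"
        using ne[OF y Z[of n]] klein_cosh_ge_1[OF fy fZ[of n]] by (intro power_mono) auto
      then have 2: "(1 - f y \<bullet> ?w)\<^sup>2 * ((1 - y \<bullet> y) * (1 - ?z \<bullet> ?z))
          \<le> (1 - y \<bullet> ?z)\<^sup>2 * ((1 - f y \<bullet> f y) * (1 - ?w \<bullet> ?w))"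
        using pos[OF y] pos[OF fy] pos[OF Z[of n]] pos[OF fZ[of n]]
        unfolding klein_cosh_power2[OF y Z[of n]] klein_cosh_power2[OF fy fZ[of n]]
        by (simp add: divide_le_eq le_divide_eq mult_ac)
      \<comment> \<open>Both \<open>1 - ?z \<bullet> ?z\<close> and
        \<open>1 - ?w \<bullet> ?w\<close> tend to 0, so they are compared and cancelled before the
        limit is taken. The price is the factor \<open>T n\<close>, which tends to 1.\<close>
      have "(1 - f y \<bullet> ?w)\<^sup>2 * (1 - y \<bullet> y) * (T n * (1 - ?w \<bullet> ?w))
          \<le> (1 - f y \<bullet> ?w)\<^sup>2 * (1 - y \<bullet> y) * (1 - ?z \<bullet> ?z)"
        using 1 pos[OF y] by (intro mult_left_mono) auto
      also have "\<dots> \<le> (1 - y \<bullet> ?z)\<^sup>2 * ((1 - f y \<bullet> f y) * (1 - ?w \<bullet> ?w))"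
        using 2 by (simp add: mult.assoc)
      finally have "(T n * (1 - f y \<bullet> ?w)\<^sup>2 * (1 - y \<bullet> y)) * (1 - ?w \<bullet> ?w)
          \<le> ((1 - y \<bullet> ?z)\<^sup>2 * (1 - f y \<bullet> f y)) * (1 - ?w \<bullet> ?w)"
        by (simp add: mult_ac)
      then show "T n * (1 - f y \<bullet> ?w)\<^sup>2 * (1 - y \<bullet> y) \<le> (1 - y \<bullet> ?z)\<^sup>2 * (1 - f y \<bullet> f y)"
        using pos[OF fZ[of n]] by simp
    qed
  qed
qed

text \<open>A closed horoball touches the sphere only at its base point. For different base points
  the horoballs through the origin thus meet in a nonempty compact convex subset of the open ball;
  it is invariant, and Brouwer yields a forbidden fixed point.\<close>

lemma klein_invariant_horoballs_unique:
  fixes f :: "'b::euclidean_space \<Rightarrow> 'b"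
  assumes f: "f \<in> ball 0 1 \<rightarrow> ball 0 1" and cont: "continuous_on (ball 0 1) f"
    and nofix: "\<And>x. x \<in> ball 0 1 \<Longrightarrow> f x \<noteq> x"
    and norms: "norm \<xi> = 1" "norm \<eta> = 1"
    and \<xi>: "\<And>y. y \<in> ball 0 1 \<Longrightarrow> (1 - f y \<bullet> \<xi>)\<^sup>2 * (1 - y \<bullet> y) \<le> (1 - y \<bullet> \<xi>)\<^sup>2 * (1 - f y \<bullet> f y)"
    and \<eta>: "\<And>y. y \<in> ball 0 1 \<Longrightarrow> (1 - f y \<bullet> \<eta>)\<^sup>2 * (1 - y \<bullet> y) \<le> (1 - y \<bullet> \<eta>)\<^sup>2 * (1 - f y \<bullet> f y)"
  shows "\<xi> = \<eta>"
proof (rule ccontr)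
  assume neq: "\<xi> \<noteq> \<eta>"
  \<comment> \<open>This is the closed horoball at \<open>\<zeta>\<close> whose boundary passes
    through the origin, with \<open>\<zeta>\<close> itself included. Written as a sublevel set of a
    continuous convex function, it is visibly closed and convex.\<close>
  define H :: "'b \<Rightarrow> 'b set" where "H \<zeta> = {y. (1 - y \<bullet> \<zeta>)\<^sup>2 + (norm y)\<^sup>2 \<le> 1}" for \<zeta>
  have H_iff: "y \<in> H \<zeta> \<longleftrightarrow> (1 - y \<bullet> \<zeta>)\<^sup>2 \<le> 1 - y \<bullet> y" for y \<zeta>
    by (auto simp: H_def power2_norm_eq_inner)
  have cball: "norm y \<le> 1" if "y \<in> H \<zeta>" for y \<zeta>
  proof -
    have "(norm y)\<^sup>2 \<le> 1\<^sup>2" using that order_trans[OF add_increasing[OF zero_le_power2 order_refl]]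
      by (fastforce simp: H_def)
    then show ?thesis by (rule power2_le_imp_le) simp
  qed
  \<comment> \<open>On the sphere the defining inequality forces
    \<open>y \<bullet> \<zeta> = 1\<close>, which for unit vectors means equality.\<close>
  have sphere: "y = \<zeta>" if "y \<in> H \<zeta>" "norm y = 1" "norm \<zeta> = 1" for y \<zeta>
  proof -
    have "(1 - y \<bullet> \<zeta>)\<^sup>2 \<le> 0" using that by (simp add: H_def)
    then have "y \<bullet> \<zeta> = 1" by simp
    then have "(norm (y - \<zeta>))\<^sup>2 = 0"
      using one_minus_inner_polarization[of y \<zeta>] that by (simp add: dot_square_norm)
    then show ?thesis by simp
  qed
  have convex: "convex (H \<zeta>)" for \<zeta>
  proof (rule convexI)
    fix x y and u v :: real
    assume xy: "x \<in> H \<zeta>" "y \<in> H \<zeta>" and uv: "0 \<le> u" "0 \<le> v" "u + v = 1"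
    have sq: "(u * A + v * B)\<^sup>2 \<le> u * A\<^sup>2 + v * B\<^sup>2" for A B :: real
      using convex_onD[OF convex_power2, of v A B] uv by (simp add: eq_diff_eq[symmetric])
    have "1 - (u *\<^sub>R x + v *\<^sub>R y) \<bullet> \<zeta> = u * (1 - x \<bullet> \<zeta>) + v * (1 - y \<bullet> \<zeta>)"
      using uv by (simp add: algebra_simps)
    then have 1: "(1 - (u *\<^sub>R x + v *\<^sub>R y) \<bullet> \<zeta>)\<^sup>2 \<le> u * (1 - x \<bullet> \<zeta>)\<^sup>2 + v * (1 - y \<bullet> \<zeta>)\<^sup>2"
      using sq by simp
    have "norm (u *\<^sub>R x + v *\<^sub>R y) \<le> u * norm x + v * norm y"
      using uv by (intro norm_triangle_le) simp
    then have "(norm (u *\<^sub>R x + v *\<^sub>R y))\<^sup>2 \<le> (u * norm x + v * norm y)\<^sup>2"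
      by (intro power_mono) auto
    also have "\<dots> \<le> u * (norm x)\<^sup>2 + v * (norm y)\<^sup>2" by (rule sq)
    finally have "(1 - (u *\<^sub>R x + v *\<^sub>R y) \<bullet> \<zeta>)\<^sup>2 + (norm (u *\<^sub>R x + v *\<^sub>R y))\<^sup>2
        \<le> u * ((1 - x \<bullet> \<zeta>)\<^sup>2 + (norm x)\<^sup>2) + v * ((1 - y \<bullet> \<zeta>)\<^sup>2 + (norm y)\<^sup>2)"
      using 1 by (simp add: algebra_simps)
    also have "\<dots> \<le> u * 1 + v * 1"
      using xy uv by (intro add_mono mult_left_mono) (auto simp: H_def)
    finally show "u *\<^sub>R x + v *\<^sub>R y \<in> H \<zeta>" using uv by (simp add: H_def)
  qed
  have closed: "closed (H \<zeta>)" for \<zeta>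
    unfolding H_def by (intro closed_Collect_le continuous_intros)
  let ?K = "H \<xi> \<inter> H \<eta>"
  have "?K \<subseteq> cball 0 1" using cball by auto
  then have "compact ?K"
    using closed by (auto simp: compact_eq_bounded_closed intro: bounded_subset)
  have K: "?K \<subseteq> ball 0 1"
  proof
    fix y assume y: "y \<in> ?K"
    then have "norm y \<noteq> 1" using sphere norms neq by blast
    then show "y \<in> ball 0 1" using cball y by fastforce
  qed
  have inv: "f y \<in> H \<zeta>"
    if y: "y \<in> H \<zeta>" "y \<in> ball 0 1"
      and le: "(1 - f y \<bullet> \<zeta>)\<^sup>2 * (1 - y \<bullet> y) \<le> (1 - y \<bullet> \<zeta>)\<^sup>2 * (1 - f y \<bullet> f y)" for y \<zeta>
  proof -
    have fy: "f y \<in> ball 0 1" using f y by auto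
    note le
    also have "(1 - y \<bullet> \<zeta>)\<^sup>2 * (1 - f y \<bullet> f y) \<le> (1 - y \<bullet> y) * (1 - f y \<bullet> f y)"
      using y one_minus_inner_self_pos[OF fy] by (intro mult_right_mono) (auto simp: H_iff)
    finally have "(1 - f y \<bullet> \<zeta>)\<^sup>2 * (1 - y \<bullet> y) \<le> (1 - f y \<bullet> f y) * (1 - y \<bullet> y)"
      by (simp add: mult.commute)
    then show ?thesis
      using one_minus_inner_self_pos[OF y(2)] by (simp add: H_iff)
  qed
  have "f \<in> ?K \<rightarrow> ?K" using inv \<xi> \<eta> K by blast
  moreover have "0 \<in> ?K" by (simp add: H_def)
  ultimately obtain y where "y \<in> ?K" "f y = y"
    using brouwer[of ?K f] \<open>compact ?K\<close> convex convex_Int continuous_on_subset[OF cont K]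
    by (metis empty_iff)
  with K nofix show False by blast
qed

section \<open>Uniform convergence in the ball\<close>

text \<open>All cluster points of solutions with parameters tending to infinity coincide, even when
  \<open>x\<close> varies along the sequence. Compactness of the closed ball turns this into
  convergence uniform in \<open>x\<close>.\<close>

lemma klein_resolvents_converge:
  fixes f :: "'b::euclidean_space \<Rightarrow> 'b"
  assumes f: "f \<in> ball 0 1 \<rightarrow> ball 0 1"
    and ne: "\<And>x y. x \<in> ball 0 1 \<Longrightarrow> y \<in> ball 0 1 \<Longrightarrow> klein_cosh (f x) (f y) \<le> klein_cosh x y"
    and nofix: "\<And>x. x \<in> ball 0 1 \<Longrightarrow> f x \<noteq> x"
  obtains \<xi> where "norm \<xi> = 1"
    and "\<And>e. 0 < e \<Longrightarrow> \<forall>\<^sub>F l in at_top. \<forall>x\<in>ball 0 1. \<forall>z\<in>ball 0 1.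
           (1 / (1 + l)) *\<^sub>R x + (l / (1 + l)) *\<^sub>R f z = z \<longrightarrow> dist z \<xi> < e"
proof -
  define horo :: "'b \<Rightarrow> bool" where "horo \<zeta> \<longleftrightarrow> norm \<zeta> = 1 \<and> (\<forall>y\<in>ball 0 1.
      (1 - f y \<bullet> \<zeta>)\<^sup>2 * (1 - y \<bullet> y) \<le> (1 - y \<bullet> \<zeta>)\<^sup>2 * (1 - f y \<bullet> f y))" for \<zeta>
  \<comment> \<open>The bound by \<open>Suc n\<close> makes every \<open>l n\<close> positive and
    drives \<open>l\<close> to infinity, so the weights \<open>T n\<close> lie strictly between 0
    and 1 and tend to 1.\<close>
  have cluster: "\<exists>\<zeta> r. strict_mono r \<and> (Z \<circ> r) \<longlonglongrightarrow> \<zeta> \<and> horo \<zeta>"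
    if l: "\<And>n. real (Suc n) \<le> l n" and X: "\<And>n. X n \<in> ball 0 1" and Z: "\<And>n. Z n \<in> ball 0 1"
      and eq: "\<And>n. (1 / (1 + l n)) *\<^sub>R X n + (l n / (1 + l n)) *\<^sub>R f (Z n) = Z n"
    for l :: "nat \<Rightarrow> real" and X Z :: "nat \<Rightarrow> 'b"
  proof -
    define T where "T n = l n / (1 + l n)" for n
    have lpos: "0 < l n" for n using l[of n] by simp
    have T1: "1 - T n = 1 / (1 + l n)" for n
      using lpos[of n] by (simp add: T_def field_simps)
    have eqT: "(1 - T n) *\<^sub>R X n + T n *\<^sub>R f (Z n) = Z n" for n
      unfolding T1 unfolding T_def by (rule eq)
    have T: "0 < T n" "T n < 1" for n
      using lpos[of n] by (auto simp: T_def)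
    have "filterlim l at_top sequentially"
      by (rule filterlim_at_top_mono[OF filterlim_compose[OF filterlim_real_sequentially filterlim_Suc]])
        (rule always_eventually, use l in blast)
    then have "filterlim (\<lambda>n. 1 + l n) at_top sequentially"
      by (intro filterlim_tendsto_add_at_top[OF tendsto_const])
    then have "(\<lambda>n. 1 / (1 + l n)) \<longlonglongrightarrow> 0"
      using tendsto_divide_0[OF tendsto_const filterlim_at_top_imp_at_infinity] by blast
    then have "(\<lambda>n. 1 - (1 - T n)) \<longlonglongrightarrow> 1 - 0"
      unfolding T1 by (intro tendsto_diff tendsto_const)
    then have Tlim: "T \<longlonglongrightarrow> 1" by simp
    have "\<And>n. Z n \<in> cball 0 1" using Z by (auto simp: less_imp_le)
    then obtain \<zeta> r where r: "strict_mono r" "(Z \<circ> r) \<longlonglongrightarrow> \<zeta>"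
      using compact_cball[of "0::'b" 1] unfolding compact_def by blast
    have "(T \<circ> r) \<longlonglongrightarrow> 1" using LIMSEQ_subseq_LIMSEQ[OF Tlim r(1)] .
    then have "horo \<zeta>"
      using klein_resolvent_cluster_point[OF f ne nofix, of "X \<circ> r" "Z \<circ> r" "T \<circ> r" \<zeta>] X Z T eqT r(2)
      by (auto simp: horo_def)
    with r show ?thesis by blast
  qed
  have uniq: "\<zeta> = \<zeta>'" if "horo \<zeta>" "horo \<zeta>'" for \<zeta> \<zeta>'
    using klein_invariant_horoballs_unique[OF f klein_nonexpansive_imp_continuous_on[OF f ne] nofix] that
    by (simp add: horo_def)
  \<comment> \<open>The limit \<open>\<xi>\<close> is obtained as a cluster point of the resolvents
    of the origin with parameters \<open>n + 1\<close>.\<close>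
  have "\<exists>z. z \<in> ball 0 1 \<and> (1 / (1 + real (Suc n))) *\<^sub>R 0 + (real (Suc n) / (1 + real (Suc n))) *\<^sub>R f z = z" for n
    using klein_resolvent_ex1[OF f ne, of 0 "1 / (1 + real (Suc n))" "real (Suc n) / (1 + real (Suc n))"]
    by (auto simp: add_divide_distrib[symmetric])
  then obtain Z0 where "\<And>n. Z0 n \<in> ball 0 1"
    "\<And>n. (1 / (1 + real (Suc n))) *\<^sub>R 0 + (real (Suc n) / (1 + real (Suc n))) *\<^sub>R f (Z0 n) = Z0 n"
    by metis
  then obtain \<xi> where \<xi>: "horo \<xi>"
    using cluster[of "\<lambda>n. real (Suc n)" "\<lambda>_. 0" Z0] by auto
  show ?thesis
  proof
    show "norm \<xi> = 1" using \<xi> by (simp add: horo_def)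
    fix e :: real assume e: "0 < e"
    show "\<forall>\<^sub>F l in at_top. \<forall>x\<in>ball 0 1. \<forall>z\<in>ball 0 1.
            (1 / (1 + l)) *\<^sub>R x + (l / (1 + l)) *\<^sub>R f z = z \<longrightarrow> dist z \<xi> < e"
    proof (rule ccontr)
      assume "\<not> ?thesis"
      \<comment> \<open>Failure of uniformity gives solutions that stay at distance \<open>e\<close>
        from \<open>\<xi>\<close> for arbitrarily large parameters; their cluster point would have
        to be \<open>\<xi>\<close>.\<close>
      then have "\<exists>l\<ge>real (Suc n). \<exists>x z. x \<in> ball 0 1 \<and> z \<in> ball 0 1 \<and>
          (1 / (1 + l)) *\<^sub>R x + (l / (1 + l)) *\<^sub>R f z = z \<and> e \<le> dist z \<xi>" for n
        unfolding eventually_at_top_linorder not_ex not_all not_imp by (meson not_le)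
      then obtain l X Z where lXZ: "\<And>n. real (Suc n) \<le> l n" "\<And>n. X n \<in> ball 0 1" "\<And>n. Z n \<in> ball 0 1"
        "\<And>n. (1 / (1 + l n)) *\<^sub>R X n + (l n / (1 + l n)) *\<^sub>R f (Z n) = Z n"
        and far: "\<And>n. e \<le> dist (Z n) \<xi>"
        by metis
      from cluster[OF lXZ] obtain \<zeta> r where r: "(Z \<circ> r) \<longlonglongrightarrow> \<zeta>" "horo \<zeta>" by blast
      from r(2) \<xi> have "\<zeta> = \<xi>" by (rule uniq)
      then have "\<forall>\<^sub>F n in sequentially. dist ((Z \<circ> r) n) \<xi> < e"
        using tendstoD[OF r(1) e] by simp
      then obtain n where "dist (Z (r n)) \<xi> < e"
        by (auto simp: eventually_sequentially)
      with far[of "r n"] show False by simp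
    qed
  qed
qed

section \<open>Chords of the ball and the Hilbert metric\<close>

lemma chord_ray_exit:
  fixes x y :: "'b::euclidean_space"
  assumes "x \<in> ball 0 1" "x \<noteq> y"
  obtains \<tau> where "0 < \<tau>" "norm (x - \<tau> *\<^sub>R (y - x)) = 1"
proof -
  have "x \<in> interior (ball 0 1)" "x - y \<noteq> 0" using assms by auto
  from ray_to_frontier[OF bounded_ball this] obtain \<tau> where
    "0 < \<tau>" "x + \<tau> *\<^sub>R (x - y) \<in> frontier (ball 0 1)" by blast
  then show ?thesis by (intro that[of \<tau>]) (auto simp: algebra_simps)
qed

text \<open>Of two exit points on one ray, the nearer would lie strictly between the interior point
  \<open>x\<close> and a point of the closed ball, hence in the open ball.\<close>

lemma chord_ray_exit_unique:
  fixes x w :: "'b::real_normed_vector"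
  assumes x: "x \<in> ball 0 1" and "0 \<le> \<tau>" "0 \<le> \<tau>'"
    and "norm (x - \<tau> *\<^sub>R w) = 1" "norm (x - \<tau>' *\<^sub>R w) = 1"
  shows "\<tau> = \<tau>'"
proof -
  have less: False if *: "0 \<le> s" "s < t" "norm (x - s *\<^sub>R w) = 1" "norm (x - t *\<^sub>R w) = 1" for s t
  proof -
    have "(1 - s / t) *\<^sub>R x + (s / t) *\<^sub>R (x - t *\<^sub>R w) \<in> ball 0 1"
      using x * by (intro convex_comb_in_ball) auto
    also have "(1 - s / t) *\<^sub>R x + (s / t) *\<^sub>R (x - t *\<^sub>R w) = x - s *\<^sub>R w"
      using * by (simp add: algebra_simps)
    finally show False using * by simp
  qed
  show ?thesis using less[of \<tau> \<tau>'] less[of \<tau>' \<tau>] assms by (meson linorder_neqE_linordered_idom)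
qed

text \<open>The power of the point \<open>x\<close> along a chord: adding \<open>\<rho>\<close>
  times the first sphere equation to \<open>\<tau>\<close> times the second eliminates
  \<open>x \<bullet> w\<close>.\<close>

lemma chord_power_of_point:
  fixes x w :: "'b::real_inner"
  assumes "0 < \<tau>" "0 < \<rho>" "norm (x - \<tau> *\<^sub>R w) = 1" "norm (x + \<rho> *\<^sub>R w) = 1"
  shows "1 - x \<bullet> x = \<tau> * \<rho> * (w \<bullet> w)"
proof -
  have "(x - \<tau> *\<^sub>R w) \<bullet> (x - \<tau> *\<^sub>R w) = 1" "(x + \<rho> *\<^sub>R w) \<bullet> (x + \<rho> *\<^sub>R w) = 1"
    using assms by (simp_all add: dot_square_norm)
  then have 1: "x \<bullet> x - 2 * \<tau> * (x \<bullet> w) + \<tau>\<^sup>2 * (w \<bullet> w) = 1"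
    and 2: "x \<bullet> x + 2 * \<rho> * (x \<bullet> w) + \<rho>\<^sup>2 * (w \<bullet> w) = 1"
    by (simp_all add: inner_commute power2_eq_square algebra_simps)
  have "(\<tau> + \<rho>) * (1 - x \<bullet> x) = (\<tau> + \<rho>) * (\<tau> * \<rho> * (w \<bullet> w))"
    using 1 2 by algebra
  then show ?thesis using assms by simp
qed

lemma norm_boundary_affine_ball:
  fixes L :: "'b::euclidean_space \<Rightarrow> 'a::real_normed_vector"
  assumes "linear L" "inj L"
  shows "norm_boundary ((\<lambda>v. c + L v) ` ball 0 1) = (\<lambda>v. c + L v) ` sphere 0 1"
proof -
  let ?\<phi> = "\<lambda>v. c + L v"
  have "bounded_linear L" using assms(1) by (simp add: linear_conv_bounded_linear)
  then have cont: "continuous_on S ?\<phi>" for S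
    by (intro continuous_intros linear_continuous_on)
  have "closed (?\<phi> ` cball 0 1)"
    by (intro compact_imp_closed compact_continuous_image cont compact_cball)
  then have "closure (?\<phi> ` ball 0 1) \<subseteq> ?\<phi> ` cball 0 1"
    by (intro closure_minimal image_mono) auto
  moreover have "?\<phi> ` closure (ball 0 1) \<subseteq> closure (?\<phi> ` ball 0 1)"
    by (intro image_closure_subset cont closed_closure closure_subset)
  ultimately have "closure (?\<phi> ` ball 0 1) = ?\<phi> ` cball 0 1" by simp
  moreover have "inj ?\<phi>" using assms(2) by (simp add: inj_def)
  ultimately show ?thesis
    by (simp add: norm_boundary_def image_set_diff[symmetric] cball_diff_eq_sphere)
qed

text \<open>Injective affine maps preserve lines and betweenness, so the exit parameter
  \<open>\<tau>\<close> found in the unit ball carries over unchanged.\<close>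

lemma exit_point_affine_ball:
  fixes L :: "'b::euclidean_space \<Rightarrow> 'a::real_normed_vector"
  assumes L: "linear L" "inj L" and x: "x \<in> ball 0 1" and "x \<noteq> y"
    and \<tau>: "0 < \<tau>" "norm (x - \<tau> *\<^sub>R (y - x)) = 1"
  shows "exit_point ((\<lambda>v. c + L v) ` ball 0 1) (c + L x) (c + L y) = c + L (x - \<tau> *\<^sub>R (y - x))"
  unfolding exit_point_def norm_boundary_affine_ball[OF L]
proof (rule the_equality)
  note lin = linear_add[OF L(1)] linear_diff[OF L(1)] linear_scale[OF L(1)]
  let ?a = "x - \<tau> *\<^sub>R (y - x)"
  have "c + L ?a = (1 + \<tau>) *\<^sub>R (c + L x) + (- \<tau>) *\<^sub>R (c + L y)"
    by (simp add: lin algebra_simps)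
  moreover have "(1 + \<tau>) + (- \<tau>) = 1" by simp
  ultimately have "c + L ?a \<in> affine hull {c + L x, c + L y}"
    unfolding affine_hull_2 by blast
  moreover have "c + L x \<in> closed_segment (c + L ?a) (c + L y)"
    unfolding in_segment
  proof (intro exI conjI)
    \<comment> \<open>The point \<open>x\<close> divides the segment from the exit point to
      \<open>y\<close> in the ratio \<open>\<tau>\<close> to 1.\<close>
    have "(1 - \<tau> / (1 + \<tau>)) *\<^sub>R ?a + (\<tau> / (1 + \<tau>)) *\<^sub>R y = x"
    proof -
      have "1 - \<tau> / (1 + \<tau>) = 1 / (1 + \<tau>)" using \<tau> by (simp add: field_simps)
      moreover have "?a + \<tau> *\<^sub>R y = (1 + \<tau>) *\<^sub>R x" by (simp add: algebra_simps)
      then have "(1 / (1 + \<tau>)) *\<^sub>R (?a + \<tau> *\<^sub>R y) = x" using \<tau>(1) by simp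
      ultimately show ?thesis by (simp only: scaleR_add_right scaleR_scaleR) simp
    qed
    then have "L x = (1 - \<tau> / (1 + \<tau>)) *\<^sub>R L ?a + (\<tau> / (1 + \<tau>)) *\<^sub>R L y"
      by (metis lin(1,3))
    then show "c + L x = (1 - \<tau> / (1 + \<tau>)) *\<^sub>R (c + L ?a) + (\<tau> / (1 + \<tau>)) *\<^sub>R (c + L y)"
      by (simp add: algebra_simps)
  qed (use \<tau> in auto)
  ultimately show "c + L ?a \<in> affine hull {c + L x, c + L y} \<and>
      c + L ?a \<in> (\<lambda>v. c + L v) ` sphere 0 1 \<and> c + L x \<in> closed_segment (c + L ?a) (c + L y)"
    using \<tau> by auto
  fix a assume "a \<in> affine hull {c + L x, c + L y} \<and>
      a \<in> (\<lambda>v. c + L v) ` sphere 0 1 \<and> c + L x \<in> closed_segment a (c + L y)"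
  then obtain a0 k where a0: "a = c + L a0" "norm a0 = 1" and k: "0 \<le> k" "k \<le> 1"
    and seg: "c + L x = (1 - k) *\<^sub>R (c + L a0) + k *\<^sub>R (c + L y)"
    by (auto simp: in_segment)
  have "L x = L ((1 - k) *\<^sub>R a0 + k *\<^sub>R y)"
    using seg by (simp add: lin algebra_simps)
  then have xeq: "x = (1 - k) *\<^sub>R a0 + k *\<^sub>R y" using L(2) by (simp add: inj_eq)
  with \<open>x \<noteq> y\<close> have "k \<noteq> 1" by auto
  with k have k1: "k < 1" by simp
  have "(1 - k) *\<^sub>R a0 = (1 - k) *\<^sub>R (x - (k / (1 - k)) *\<^sub>R (y - x))"
    using k1 xeq by (simp add: scaleR_diff_right) (simp add: algebra_simps)
  then have "a0 = x - (k / (1 - k)) *\<^sub>R (y - x)" using k1 by simp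
  moreover from this have "k / (1 - k) = \<tau>"
    using chord_ray_exit_unique[OF x, of "k / (1 - k)" \<tau> "y - x"] \<tau> a0 k k1 by simp
  ultimately show "a = c + L ?a" using a0 by simp
qed

text \<open>\<open>Q\<close> is the cross ratio of the chord, and
  \<open>(Q + 1)\<^sup>2 / (4 * Q)\<close> is the square of \<open>cosh (ln Q / 2)\<close>. Both
  sides are computed from the exit parameters \<open>\<tau>\<close> and
  \<open>\<sigma>\<close>.\<close>

lemma hilbert_metric_affine_ball:
  fixes L :: "'b::euclidean_space \<Rightarrow> 'a::real_normed_vector"
  assumes L: "linear L" "inj L" and x: "x \<in> ball 0 1" and y: "y \<in> ball 0 1"
  obtains Q where "1 \<le> Q" "hilbert_metric ((\<lambda>v. c + L v) ` ball 0 1) (c + L x) (c + L y) = ln Q"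
    "(klein_cosh x y)\<^sup>2 = (Q + 1)\<^sup>2 / (4 * Q)"
proof (cases "x = y")
  case True
  then show ?thesis by (intro that[of 1]) (auto simp: hilbert_metric_def klein_cosh_self[OF y])
next
  case False
  note lin = linear_add[OF L(1)] linear_diff[OF L(1)] linear_scale[OF L(1)]
  define w where "w = y - x"
  have y_eq: "y = x + w" by (simp add: w_def)
  obtain \<tau> where \<tau>: "0 < \<tau>" "norm (x - \<tau> *\<^sub>R (y - x)) = 1"
    using chord_ray_exit[OF x False] .
  obtain \<sigma> where \<sigma>: "0 < \<sigma>" "norm (y - \<sigma> *\<^sub>R (x - y)) = 1"
    using chord_ray_exit[OF y False[symmetric]] .
  define N where "N = norm (L w)"
  have "L w \<noteq> 0"
    using L False by (metis injD linear_0 right_minus_eq w_def)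
  then have N: "0 < N" by (simp add: N_def)
  let ?D = "(\<lambda>v. c + L v) ` ball 0 1"
  have ex: "exit_point ?D (c + L x) (c + L y) = c + L (x - \<tau> *\<^sub>R (y - x))"
    "exit_point ?D (c + L y) (c + L x) = c + L (y - \<sigma> *\<^sub>R (x - y))"
    using exit_point_affine_ball[OF L x False \<tau>] exit_point_affine_ball[OF L y False[symmetric] \<sigma>]
    by auto
  \<comment> \<open>All differences along the chord are multiples of \<open>L w\<close>, so its norm
    cancels and the cross ratio does not depend on the chosen norm.\<close>
  have diffs: "c + L y - (c + L (x - \<tau> *\<^sub>R (y - x))) = (1 + \<tau>) *\<^sub>R L w"
    "c + L x - (c + L (y - \<sigma> *\<^sub>R (x - y))) = - ((1 + \<sigma>) *\<^sub>R L w)"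
    "c + L x - (c + L (x - \<tau> *\<^sub>R (y - x))) = \<tau> *\<^sub>R L w"
    "c + L y - (c + L (y - \<sigma> *\<^sub>R (x - y))) = - (\<sigma> *\<^sub>R L w)"
    by (simp_all add: w_def lin algebra_simps)
  define Q where "Q = (1 + \<tau>) * (1 + \<sigma>) / (\<tau> * \<sigma>)"
  have "c + L x \<noteq> c + L y" using L(2) False by (simp add: inj_eq)
  then have "hilbert_metric ?D (c + L x) (c + L y)
      = ln (((1 + \<tau>) * N * ((1 + \<sigma>) * N)) / (\<tau> * N * (\<sigma> * N)))"
    unfolding hilbert_metric_def Let_def ex diffs using \<tau> \<sigma> by (simp add: N_def)
  also have "((1 + \<tau>) * N * ((1 + \<sigma>) * N)) / (\<tau> * N * (\<sigma> * N)) = Q"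
    using N \<tau> \<sigma> by (simp add: Q_def)
  finally have metric: "hilbert_metric ?D (c + L x) (c + L y) = ln Q" .
  have Q1: "1 \<le> Q" using \<tau> \<sigma> by (simp add: Q_def le_divide_eq algebra_simps)
  define W where "W = w \<bullet> w"
  have W: "0 < W" using False by (simp add: W_def w_def)
  \<comment> \<open>Seen from \<open>x\<close>, the chord ends at the parameters
    \<open>\<tau>\<close> and \<open>1 + \<sigma>\<close>; seen from \<open>y\<close>, at
    \<open>1 + \<tau>\<close> and \<open>\<sigma>\<close>.\<close>
  have xx: "1 - x \<bullet> x = \<tau> * (1 + \<sigma>) * W"
    unfolding W_def using \<tau> \<sigma>
    by (intro chord_power_of_point) (simp_all add: w_def algebra_simps)
  have yy: "1 - y \<bullet> y = (1 + \<tau>) * \<sigma> * W"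
    unfolding W_def using \<tau> \<sigma>
    by (intro chord_power_of_point) (simp_all add: w_def algebra_simps)
  have "2 * (1 - x \<bullet> y) = \<tau> * (1 + \<sigma>) * W + (1 + \<tau>) * \<sigma> * W + W"
    using one_minus_inner_polarization[of x y] xx yy
    by (simp add: W_def w_def norm_minus_commute dot_square_norm)
  then have xy: "1 - x \<bullet> y = ((1 + \<tau>) * (1 + \<sigma>) + \<tau> * \<sigma>) * W / 2"
    by (simp add: algebra_simps)
  have "(klein_cosh x y)\<^sup>2
      = (((1 + \<tau>) * (1 + \<sigma>) + \<tau> * \<sigma>) * W / 2)\<^sup>2 / ((\<tau> * (1 + \<sigma>) * W) * ((1 + \<tau>) * \<sigma> * W))"
    unfolding klein_cosh_power2[OF x y] xx yy xy ..
  also have "\<dots> = ((1 + \<tau>) * (1 + \<sigma>) + \<tau> * \<sigma>)\<^sup>2 / (4 * ((1 + \<tau>) * (1 + \<sigma>)) * (\<tau> * \<sigma>))"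
    using W by (simp add: power_mult_distrib power_divide) (simp add: power2_eq_square)
  also have "\<dots> = (Q + 1)\<^sup>2 / (4 * Q)"
  proof -
    have "(A + B)\<^sup>2 / (4 * A * B) = (A / B + 1)\<^sup>2 / (4 * (A / B))" if "0 < A" "0 < B" for A B :: real
      using that by (simp add: field_simps power2_eq_square)
    then show ?thesis using \<tau> \<sigma> by (simp add: Q_def)
  qed
  finally show ?thesis using that metric Q1 by blast
qed

lemma hilbert_metric_le_imp_klein_cosh_le:
  fixes L :: "'b::euclidean_space \<Rightarrow> 'a::real_normed_vector"
  assumes L: "linear L" "inj L"
    and xy: "x \<in> ball 0 1" "y \<in> ball 0 1" and uv: "u \<in> ball 0 1" "v \<in> ball 0 1"
    and le: "hilbert_metric ((\<lambda>v. c + L v) ` ball 0 1) (c + L x) (c + L y)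
      \<le> hilbert_metric ((\<lambda>v. c + L v) ` ball 0 1) (c + L u) (c + L v)"
  shows "klein_cosh x y \<le> klein_cosh u v"
proof -
  obtain P where P: "1 \<le> P" "hilbert_metric ((\<lambda>v. c + L v) ` ball 0 1) (c + L x) (c + L y) = ln P"
    "(klein_cosh x y)\<^sup>2 = (P + 1)\<^sup>2 / (4 * P)"
    using hilbert_metric_affine_ball[OF L xy] .
  obtain Q where Q: "1 \<le> Q" "hilbert_metric ((\<lambda>v. c + L v) ` ball 0 1) (c + L u) (c + L v) = ln Q"
    "(klein_cosh u v)\<^sup>2 = (Q + 1)\<^sup>2 / (4 * Q)"
    using hilbert_metric_affine_ball[OF L uv] .
  have "P \<le> Q" using le P(1,2) Q(1,2) by simp
  moreover have "1 \<le> P * Q" using P(1) Q(1) mult_mono[of 1 P 1 Q] by simp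
  \<comment> \<open>This product is exactly
    \<open>(Q + 1)\<^sup>2 * P - (P + 1)\<^sup>2 * Q\<close>, which shows that
    \<open>(Q + 1)\<^sup>2 / (4 * Q)\<close> increases for \<open>Q\<close> at least 1.\<close>
  ultimately have "0 \<le> (Q - P) * (P * Q - 1)" by simp
  then have "(P + 1)\<^sup>2 * Q \<le> (Q + 1)\<^sup>2 * P"
    by (simp add: power2_eq_square algebra_simps)
  then have "(klein_cosh x y)\<^sup>2 \<le> (klein_cosh u v)\<^sup>2"
    unfolding P(3) Q(3) using P(1) Q(1) by (simp add: divide_simps)
  then show ?thesis
    by (rule power2_le_imp_le) (use klein_cosh_ge_1[OF uv] in simp)
qed

section \<open>Transfer to the ellipsoid\<close>

theorem corollary4p5:
  fixes D :: "'a::real_normed_vector set" and F :: "'a \<Rightarrow> 'a"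
  assumes "\<exists>B :: 'a set. finite B \<and> span B = UNIV"
    and "ellipsoid TYPE('n::finite) D"
    and "F \<in> D \<rightarrow> D"
    and "hilbert_nonexpansive D F"
    and "\<forall>x\<in>D. F x \<noteq> x"
  shows "\<exists>\<xi>\<in>norm_boundary D. \<forall>K. K \<subseteq> D \<and> hilbert_bounded D K \<longrightarrow>
           uniform_limit K (resolvent D F) (\<lambda>_. \<xi>) at_top"
proof -
  obtain L0 :: "real ^ 'n \<Rightarrow> 'a" and c0 p r where L0: "linear L0" "bij L0" and r: "0 < r"
    and D0: "D = (\<lambda>v. c0 + L0 v) ` ball p r"
    using assms(2) unfolding ellipsoid_def by blast
  \<comment> \<open>Radius and center of the given ball are absorbed into the affine map, so that
    \<open>D\<close> becomes the image of the unit ball.\<close>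
  define L where "L v = r *\<^sub>R L0 v" for v
  define c where "c = c0 + L0 p"
  define \<phi> where "\<phi> v = c + L v" for v
  have L: "linear L" unfolding L_def using L0(1) by (intro linear_compose_scale_right)
  have "inj L" using L0(2) r by (auto simp: L_def inj_def bij_def)
  note lin = linear_add[OF L] linear_diff[OF L] linear_scale[OF L]
  have "ball p r = (+) p ` ball 0 r" using ball_translation[of p 0 r] by simp
  also have "ball 0 r = (*\<^sub>R) r ` ball (0 :: real ^ 'n) 1"
    by (rule sym) (use ball_scale[of r "0 :: real ^ 'n" 1] r in simp)
  finally have "ball p r = (\<lambda>v. p + r *\<^sub>R v) ` ball 0 1" by (simp add: image_image)
  then have D: "D = \<phi> ` ball 0 1"
    by (simp add: D0 \<phi>_def L_def c_def image_image linear_add[OF L0(1)] linear_scale[OF L0(1)]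
        add.assoc)
  have inj: "inj \<phi>" using \<open>inj L\<close> by (simp add: inj_def \<phi>_def)
  \<comment> \<open>\<open>F\<close> is conjugated to a self-map of the unit ball; only its values
    on the ball matter.\<close>
  define f where "f v = inv \<phi> (F (\<phi> v))" for v
  have f: "f v \<in> ball 0 1 \<and> \<phi> (f v) = F (\<phi> v)" if "v \<in> ball 0 1" for v
  proof -
    have "F (\<phi> v) \<in> D" using assms(3) that D by blast
    then obtain u where "u \<in> ball 0 1" "F (\<phi> v) = \<phi> u" using D by blast
    then show ?thesis using inj by (simp add: f_def)
  qed
  have maps: "f \<in> ball 0 1 \<rightarrow> ball 0 1" using f by blast
  have ne: "klein_cosh (f u) (f v) \<le> klein_cosh u v" if "u \<in> ball 0 1" "v \<in> ball 0 1" for u v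
  proof (rule hilbert_metric_le_imp_klein_cosh_le[OF L \<open>inj L\<close>])
    have "hilbert_metric D (F (\<phi> u)) (F (\<phi> v)) \<le> hilbert_metric D (\<phi> u) (\<phi> v)"
      using assms(4) that D by (auto simp: hilbert_nonexpansive_def)
    then show "hilbert_metric ((\<lambda>v. c + L v) ` ball 0 1) (c + L (f u)) (c + L (f v))
        \<le> hilbert_metric ((\<lambda>v. c + L v) ` ball 0 1) (c + L u) (c + L v)"
      using f that by (simp add: D \<phi>_def)
  qed (use f that in auto)
  have nofix: "f v \<noteq> v" if "v \<in> ball 0 1" for v
    using assms(5) f[OF that] that D by force
  obtain \<xi> where \<xi>: "norm \<xi> = 1"
    and lim: "\<And>e. 0 < e \<Longrightarrow> \<forall>\<^sub>F l in at_top. \<forall>x\<in>ball 0 1. \<forall>z\<in>ball 0 1.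
      (1 / (1 + l)) *\<^sub>R x + (l / (1 + l)) *\<^sub>R f z = z \<longrightarrow> dist z \<xi> < e"
    using klein_resolvents_converge[OF maps ne nofix] by blast
  have comb: "s *\<^sub>R \<phi> u + t *\<^sub>R \<phi> v = \<phi> (s *\<^sub>R u + t *\<^sub>R v)" if "s + t = 1" for s t u v
    using that by (simp add: \<phi>_def lin algebra_simps flip: scaleR_add_left)
  \<comment> \<open>Affine maps commute with combinations of total weight 1, so
    \<open>\<phi>\<close> maps solutions of the resolvent equation for \<open>f\<close> to those for
    \<open>F\<close>; uniqueness in the ball evaluates the definite description.\<close>
  have res: "\<exists>z\<in>ball 0 1. (1 / (1 + l)) *\<^sub>R x + (l / (1 + l)) *\<^sub>R f z = z \<and> resolvent D F l (\<phi> x) = \<phi> z"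
    if l: "0 < l" and x: "x \<in> ball 0 1" for l x
  proof -
    let ?s = "1 / (1 + l)" and ?t = "l / (1 + l)"
    have st: "0 < ?s" "0 < ?t" "?s + ?t = 1"
      using l by (auto simp flip: add_divide_distrib)
    from klein_resolvent_ex1[OF maps ne x st] obtain z where z: "z \<in> ball 0 1"
      "?s *\<^sub>R x + ?t *\<^sub>R f z = z"
      and uniq: "\<And>z'. z' \<in> ball 0 1 \<Longrightarrow> ?s *\<^sub>R x + ?t *\<^sub>R f z' = z' \<Longrightarrow> z' = z"
      by metis
    have step: "?s *\<^sub>R \<phi> x + ?t *\<^sub>R F (\<phi> v) = \<phi> (?s *\<^sub>R x + ?t *\<^sub>R f v)" if "v \<in> ball 0 1" for v
      using comb[OF st(3)] f[OF that] by metis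
    have "resolvent D F l (\<phi> x) = \<phi> z"
      unfolding resolvent_def
    proof (rule the_equality)
      show "\<phi> z \<in> D \<and> ?s *\<^sub>R \<phi> x + ?t *\<^sub>R F (\<phi> z) = \<phi> z"
        using z step[OF z(1)] D by simp
      fix y assume y: "y \<in> D \<and> ?s *\<^sub>R \<phi> x + ?t *\<^sub>R F y = y"
      then obtain v where v: "v \<in> ball 0 1" "y = \<phi> v" using D by blast
      with y step[OF v(1)] have "?s *\<^sub>R x + ?t *\<^sub>R f v = v" using inj by (simp add: inj_eq)
      with uniq v show "y = \<phi> z" by blast
    qed
    with z show ?thesis by blast
  qed
  \<comment> \<open>The constant \<open>C\<close> converts Euclidean distances in the ball into
    distances in the given norm, whence the tolerance \<open>e / C\<close> below.\<close>
  have "bounded_linear L" using L by (simp add: linear_conv_bounded_linear)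
  then obtain C where C: "0 < C" "\<And>v. norm (L v) \<le> norm v * C"
    using bounded_linear.pos_bounded by blast
  show ?thesis
  proof (intro bexI allI impI)
    show "\<phi> \<xi> \<in> norm_boundary D"
      using norm_boundary_affine_ball[OF L \<open>inj L\<close>, of c] \<xi> by (simp add: D \<phi>_def)
    fix K assume "K \<subseteq> D \<and> hilbert_bounded D K"
    then have K: "K \<subseteq> \<phi> ` ball 0 1" using D by blast
    show "uniform_limit K (resolvent D F) (\<lambda>_. \<phi> \<xi>) at_top"
    proof (rule uniform_limitI)
      fix e :: real assume "0 < e"
      then have "0 < e / C" using C by simp
      from lim[OF this] eventually_gt_at_top[of 0]
      show "\<forall>\<^sub>F l in at_top. \<forall>x\<in>K. dist (resolvent D F l x) (\<phi> \<xi>) < e"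
      proof eventually_elim
        case (elim l)
        show ?case
        proof
          fix y assume "y \<in> K"
          with K obtain x where x: "x \<in> ball 0 1" "y = \<phi> x" by blast
          from res[OF elim(2) x(1)] obtain z where z: "z \<in> ball 0 1"
            "(1 / (1 + l)) *\<^sub>R x + (l / (1 + l)) *\<^sub>R f z = z" "resolvent D F l y = \<phi> z"
            using x by blast
          have "dist (\<phi> z) (\<phi> \<xi>) = norm (L (z - \<xi>))"
            by (simp add: dist_norm \<phi>_def lin)
          also have "\<dots> \<le> dist z \<xi> * C" using C(2)[of "z - \<xi>"] by (simp add: dist_norm)
          also have "\<dots> < e"
            using elim(1) x z C(1) by (simp add: pos_less_divide_eq)
          finally show "dist (resolvent D F l y) (\<phi> \<xi>) < e" using z by simp
        qed
      qed
    qed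
  qed
qed

end
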